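(* Let $\gamma>1$ with Hölder conjugate $\gamma^*=\frac{\gamma}{\gamma-1}$, let $a\in\mathbb{R}$, and let $k$ be a non-negative integer. Then the Leray symbol function satisfies $$J(\delta_a(\gamma),\gamma,k)=J(\delta_a(\gamma^* ),\gamma^*,k).$$
   Context: For $a\in\mathbb{R}$ and $\gamma>1$, $\delta_a(\gamma)=a(\gamma-2)+1$. For $d\in\mathbb{R}$, $\gamma>1$ and integers $k\ge0$ the Leray symbol function is $$J(d,\gamma,k)=\frac{\Gamma\left(\frac{2k+1+d}{\gamma}\right)\Gamma\left(2k+2-\frac{2k+1+d}{\gamma}\right)}{\Gamma(k+1)^2}\left(\frac{\gamma}{2}\right)^{2k+2}(\gamma-1)^{-\left(2k+2-\frac{2k+1+d}{\gamma}\right)}.$$ Convention: this formula is used when both arguments of the Gamma functions in the numerator are positive, i.e. when $-2k-1<d<(2k+2)(\gamma-1)+1$; otherwise $J(d,\gamma,k)=+\infty$. *)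

theory Defs
  imports "HOL-Analysis.Analysis"
begin

definition hoelder_conjugate :: "real \<Rightarrow> real" where
  "hoelder_conjugate \<gamma> = \<gamma> / (\<gamma> - 1)"

definition leray_delta :: "real \<Rightarrow> real \<Rightarrow> real" where
  "leray_delta a \<gamma> = a * (\<gamma> - 2) + 1"

(* Only meaningful for \<gamma> > 1. *)
definition leray_J :: "real \<Rightarrow> real \<Rightarrow> nat \<Rightarrow> ereal" where
  "leray_J d \<gamma> k =
     (if - 2 * real k - 1 < d \<and> d < (2 * real k + 2) * (\<gamma> - 1) + 1
      then ereal
        (Gamma ((2 * real k + 1 + d) / \<gamma>) * Gamma (2 * real k + 2 - (2 * real k + 1 + d) / \<gamma>)
           / (Gamma (real k + 1))\<^sup>2
         * (\<gamma> / 2) ^ (2 * k + 2)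
         * (\<gamma> - 1) powr (- (2 * real k + 2 - (2 * real k + 1 + d) / \<gamma>)))
      else \<infinity>)"

(* The range of d in leray_J is exactly where both numerator Gamma arguments are positive. *)
lemma leray_J_range_iff:
  assumes "\<gamma> > 1"
  shows "- 2 * real k - 1 < d \<and> d < (2 * real k + 2) * (\<gamma> - 1) + 1 \<longleftrightarrow>
         (2 * real k + 1 + d) / \<gamma> > 0 \<and> 2 * real k + 2 - (2 * real k + 1 + d) / \<gamma> > 0"
proof -
  have "\<gamma> > 0" using assms by simp
  then have "(2 * real k + 1 + d) / \<gamma> > 0 \<longleftrightarrow> 2 * real k + 1 + d > 0"
    by (simp add: zero_less_divide_iff)
  moreover have "2 * real k + 2 - (2 * real k + 1 + d) / \<gamma> > 0 \<longleftrightarrow>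
      2 * real k + 1 + d < (2 * real k + 2) * \<gamma>"
    using \<open>\<gamma> > 0\<close> pos_divide_less_eq[of \<gamma> "2 * real k + 1 + d" "2 * real k + 2"] by linarith
  ultimately show ?thesis by (auto simp: algebra_simps)
qed

end

theory Submission
  imports Defs
begin

text \<open>
  Put \<open>N = 2 * k + 2\<close> and let \<open>s = (2 * k + 1 + d) / \<gamma>\<close> be the first Gamma argument of the
  symbol, so that the second one is \<open>N - s\<close>. For \<open>d = leray_delta a \<gamma>\<close>, passing from \<open>\<gamma>\<close> to its
  conjugate reflects \<open>s\<close> to \<open>N - s\<close> (lemma \<open>leray_gamma_arg_conjugate\<close>). The two Gamma factors
  therefore trade places, and so do the two positivity conditions that decide whether the symbol
  is finite. What remains is the elementary factor, where \<open>\<gamma>\<^sup>* = \<gamma> / (\<gamma> - 1)\<close> and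
  \<open>\<gamma>\<^sup>* - 1 = 1 / (\<gamma> - 1)\<close> give
  \<open>(\<gamma>\<^sup>* / 2)\<^sup>N (\<gamma>\<^sup>* - 1)\<^sup>-\<^sup>s = (\<gamma> / 2)\<^sup>N (\<gamma> - 1)\<^sup>s\<^sup>-\<^sup>N\<close>,
  which is exactly the original factor (lemma \<open>leray_elementary_factor_conjugate\<close>).
\<close>

lemma hoelder_conjugate_gt_1:
  assumes "\<gamma> > 1"
  shows "hoelder_conjugate \<gamma> > 1"
  using assms by (simp add: hoelder_conjugate_def)

lemma hoelder_conjugate_minus_1:
  assumes "\<gamma> > 1"
  shows "hoelder_conjugate \<gamma> - 1 = inverse (\<gamma> - 1)"
  using assms by (simp add: hoelder_conjugate_def field_simps)

text \<open>
  With \<open>N = x + 2\<close>, the first argument is \<open>(N + a * (\<gamma> - 2)) / \<gamma> = N / \<gamma> + a * (1 - 2 / \<gamma>)\<close>. Since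
  \<open>1 / \<gamma> + 1 / \<gamma>\<^sup>* = 1\<close>, conjugation sends \<open>N / \<gamma>\<close> to \<open>N - N / \<gamma>\<close> and changes the sign of
  \<open>1 - 2 / \<gamma>\<close>. The latter is why \<open>leray_delta\<close> has the slope \<open>\<gamma> - 2\<close>, which vanishes at the
  self-conjugate exponent.
\<close>

lemma leray_gamma_arg_conjugate:
  fixes \<gamma> a x :: real
  assumes "\<gamma> > 1"
  shows "(x + 1 + leray_delta a (hoelder_conjugate \<gamma>)) / hoelder_conjugate \<gamma>
         = x + 2 - (x + 1 + leray_delta a \<gamma>) / \<gamma>"
  using assms by (simp add: hoelder_conjugate_def leray_delta_def field_simps)

lemma leray_elementary_factor_conjugate:
  fixes \<gamma> s :: real and n :: nat
  assumes "\<gamma> > 1"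
  shows "(hoelder_conjugate \<gamma> / 2) ^ n * (hoelder_conjugate \<gamma> - 1) powr (- s)
         = (\<gamma> / 2) ^ n * (\<gamma> - 1) powr (- (real n - s))"
proof -
  have "(hoelder_conjugate \<gamma> / 2) ^ n = (\<gamma> / 2) ^ n * (\<gamma> - 1) powr (- real n)"
  proof -
    have "hoelder_conjugate \<gamma> / 2 = (\<gamma> / 2) * inverse (\<gamma> - 1)"
      by (simp add: hoelder_conjugate_def field_simps)
    then show ?thesis
      using assms by (simp only: power_mult_distrib powr_minus powr_realpow power_inverse diff_gt_0_iff_gt)
  qed
  moreover have "(hoelder_conjugate \<gamma> - 1) powr (- s) = (\<gamma> - 1) powr s"
    unfolding hoelder_conjugate_minus_1[OF assms]
    using assms by (simp only: powr_minus inverse_powr inverse_inverse_eq diff_ge_0_iff_ge less_imp_le)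
  moreover have "(\<gamma> - 1) powr (- real n) * (\<gamma> - 1) powr s = (\<gamma> - 1) powr (- (real n - s))"
    by (simp only: powr_add[symmetric] minus_diff_eq uminus_add_conv_diff)
  ultimately show ?thesis by (simp only: mult.assoc)
qed

text \<open>
  In the variable \<open>s\<close> the domain of finiteness is the interval \<open>0 < s < N\<close>, which is visibly
  invariant under the reflection of \<open>s\<close> to \<open>N - s\<close>; the bounds on \<open>d\<close> hide this symmetry.
\<close>

lemma leray_J_eq_gamma_arg:
  fixes \<gamma> d s :: real and k :: nat
  assumes "\<gamma> > 1" and s: "(2 * real k + 1 + d) / \<gamma> = s"
  shows "leray_J d \<gamma> k =
     (if 0 < s \<and> s < 2 * real k + 2
      then ereal (Gamma s * Gamma (2 * real k + 2 - s) / (Gamma (real k + 1))\<^sup>2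
             * ((\<gamma> / 2) ^ (2 * k + 2) * (\<gamma> - 1) powr (- (2 * real k + 2 - s))))
      else \<infinity>)"
  unfolding leray_J_def leray_J_range_iff[OF assms(1)] s by (simp add: mult.assoc)

theorem theorem1p18:
  fixes \<gamma> a :: real and k :: nat
  assumes "\<gamma> > 1"
  shows "leray_J (leray_delta a \<gamma>) \<gamma> k =
         leray_J (leray_delta a (hoelder_conjugate \<gamma>)) (hoelder_conjugate \<gamma>) k"
proof -
  define N where "N = 2 * real k + 2"
  define s where "s = (2 * real k + 1 + leray_delta a \<gamma>) / \<gamma>"
  have N: "real (2 * k + 2) = N" by (simp add: N_def)
  have conj: "(2 * real k + 1 + leray_delta a (hoelder_conjugate \<gamma>)) / hoelder_conjugate \<gamma> = N - s"
    unfolding N_def s_def by (rule leray_gamma_arg_conjugate[OF assms])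
  have "leray_J (leray_delta a (hoelder_conjugate \<gamma>)) (hoelder_conjugate \<gamma>) k =
     (if 0 < N - s \<and> N - s < N
      then ereal (Gamma (N - s) * Gamma (N - (N - s)) / (Gamma (real k + 1))\<^sup>2
             * ((hoelder_conjugate \<gamma> / 2) ^ (2 * k + 2)
                * (hoelder_conjugate \<gamma> - 1) powr (- (N - (N - s)))))
      else \<infinity>)"
    using leray_J_eq_gamma_arg[OF hoelder_conjugate_gt_1[OF assms] conj]
    unfolding N_def .
  also have "\<dots> =
     (if 0 < s \<and> s < N
      then ereal (Gamma s * Gamma (N - s) / (Gamma (real k + 1))\<^sup>2
             * ((\<gamma> / 2) ^ (2 * k + 2) * (\<gamma> - 1) powr (- (N - s))))
      else \<infinity>)"
  proof -
    have "0 < N - s \<and> N - s < N \<longleftrightarrow> 0 < s \<and> s < N" by auto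
    moreover have "N - (N - s) = s" by simp
    ultimately show ?thesis
      using leray_elementary_factor_conjugate[OF assms, of "2 * k + 2" s]
      unfolding N by (simp only: mult.commute[of "Gamma (N - s)"])
  qed
  also have "\<dots> = leray_J (leray_delta a \<gamma>) \<gamma> k"
    using leray_J_eq_gamma_arg[OF assms s_def[symmetric]] unfolding N_def by (rule sym)
  finally show ?thesis by (rule sym)
qed

end
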